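(* Let a Lie group $G$ act smoothly on a two-dimensional manifold $M$ with local coordinates $(x,u)$, and let $\gamma(\varepsilon)$ be a smooth curve in $G$ with $\gamma(0)=e$. Let $k\ge 0$, let $(x_i,u_i)$, $i=0,\dots,k$, be points with $x_0,\dots,x_k$ pairwise distinct, and put $(\widetilde{x}_i,\widetilde{u}_i)=\gamma(\varepsilon)\cdot(x_i,u_i)$. Then the infinitesimal $\hat{\varphi}^{(k)}_{[k]}=\left.\frac{d}{d\varepsilon}\right|_{\varepsilon=0}\hat{\widetilde{u}}^{(k)}$ of the multispace coordinate $\hat{u}^{(k)}$ is given by $$\hat{\varphi}^{(k)}_{[k]} = \hat{\varphi}^{(k)} - \frac{1}{k!}\sum_{\ell=0}^{k}\hat{\mu}^{(k)}_{\ell}\;\widehat{\bigl(\ell x^{\ell-1}\xi\bigr)}^{(k)}.$$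
   Context: For points $x_0,\dots,x_k\in\mathbb{R}$, $\Delta^{(k)}$ denotes the determinant of the $(k+1)\times(k+1)$ Vandermonde matrix whose $i$-th row is $(1,x_i,x_i^2,\dots,x_i^k)$, $i=0,\dots,k$. For a quantity $w$ with values $w_0,\dots,w_k$ at the sample points and $0\le \ell\le k$, $\Delta^{(k)}(w,x^\ell)$ denotes the determinant of the matrix obtained by replacing the column $(x_0^\ell,\dots,x_k^\ell)^T$ by $(w_0,\dots,w_k)^T$. For pairwise distinct $x_0,\dots,x_k$ define $$\hat{w}^{(k)} := k!\,\frac{\Delta^{(k)}(w,x^k)}{\Delta^{(k)}},\qquad \hat{\mu}^{(k)}_{\ell} := k!\,\frac{\Delta^{(k)}(u,x^\ell)}{\Delta^{(k)}} .$$ So $\hat{u}^{(k)}$ is $k!$ times the $k$-th divided difference of $u$ at $x_0,\dots,x_k$. The transformed coordinate $\hat{\widetilde{u}}^{(k)}$ is given by the same formula with all $(x_i,u_i)$ replaced by $(\widetilde{x}_i,\widetilde{u}_i)$, i.e. $\hat{\widetilde{u}}^{(k)}=k!\,\Delta^{(k)}(\widetilde{u},\widetilde{x}^k)/\widetilde{\Delta}^{(k)}$, where $\widetilde{\Delta}^{(k)}$ is the Vandermonde determinant of $\widetilde{x}_0,\dots,\widetilde{x}_k$ (defined for $\varepsilon$ near $0$). Writing $(\widetilde{x}(x,u;\varepsilon),\widetilde{u}(x,u;\varepsilon))=\gamma(\varepsilon)\cdot(x,u)$, set $$\xi(x,u)=\left.\frac{d}{d\varepsilon}\right|_{\varepsilon=0}\widetilde{x},\qquad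 \varphi(x,u)=\left.\frac{d}{d\varepsilon}\right|_{\varepsilon=0}\widetilde{u}.$$ In $\hat{\varphi}^{(k)}$ the values at the sample points are $\varphi_i=\varphi(x_i,u_i)$; in $\widehat{(\ell x^{\ell-1}\xi)}^{(k)}$ they are $\ell x_i^{\ell-1}\xi(x_i,u_i)$, which is taken to be $0$ for $\ell=0$. *)

theory Defs
  imports
    "HOL-Analysis.Analysis"
    "HOL-Algebra.Group_Action"
    "Jordan_Normal_Form.Determinant"
begin

section \<open>Smooth maps between open subsets of normed spaces\<close>

text \<open>Intended for open \<open>S\<close>. Quantifying over all directions \<open>v\<close> keeps the codomain type fixed
  in the recursion; on finite-dimensional domains this is the usual notion of class \<open>C^n\<close>.\<close>

primrec Ck_on :: "nat \<Rightarrow> ('a::real_normed_vector \<Rightarrow> 'b::real_normed_vector) \<Rightarrow> 'a set \<Rightarrow> bool" where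
  "Ck_on 0 f S \<longleftrightarrow> continuous_on S f"
| "Ck_on (Suc n) f S \<longleftrightarrow>
     (\<forall>x\<in>S. f differentiable (at x)) \<and>
     (\<forall>v. Ck_on n (\<lambda>x. frechet_derivative f (at x) v) S)"

definition smooth_on :: "('a::real_normed_vector \<Rightarrow> 'b::real_normed_vector) \<Rightarrow> 'a set \<Rightarrow> bool" where
  "smooth_on f S \<longleftrightarrow> (\<forall>n. Ck_on n f S)"

section \<open>Smooth manifolds, Lie groups, smooth actions\<close>

type_synonym ('m, 'e) chart = "'m set \<times> ('m \<Rightarrow> 'e)"

abbreviation chart_dom :: "('m, 'e) chart \<Rightarrow> 'm set" where
  "chart_dom \<equiv> fst"

abbreviation chart_map :: "('m, 'e) chart \<Rightarrow> 'm \<Rightarrow> 'e" where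
  "chart_map \<equiv> snd"

definition chart_inv :: "('m, 'e) chart \<Rightarrow> 'e \<Rightarrow> 'm" where
  "chart_inv c = inv_into (chart_dom c) (chart_map c)"

text \<open>The model space is a finite-dimensional normed space rather than an instance of
  \<open>euclidean_space\<close>, because the latter class excludes dimension \<open>0\<close> and hence discrete Lie groups.
  The atlas is not required to be maximal; since it is arbitrary, "a chart of the atlas" covers
  every chart of the smooth structure.\<close>

locale smooth_manifold =
  fixes M :: "'m topology" and A :: "('m, 'e::real_normed_vector) chart set"
  assumes finite_dim: "\<exists>B :: 'e set. finite B \<and> span B = UNIV"
    and Hausdorff: "Hausdorff_space M"
    and second_countable: "second_countable M"
    and chart_openin: "c \<in> A \<Longrightarrow> openin M (chart_dom c)"
    and chart_image_open: "c \<in> A \<Longrightarrow> open (chart_map c ` chart_dom c)"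
    and chart_homeo: "c \<in> A \<Longrightarrow>
      homeomorphic_map (subtopology M (chart_dom c)) (top_of_set (chart_map c ` chart_dom c))
        (chart_map c)"
    and charts_cover: "(\<Union>c\<in>A. chart_dom c) = topspace M"
    and charts_compatible: "c \<in> A \<Longrightarrow> d \<in> A \<Longrightarrow>
      smooth_on (chart_map d \<circ> chart_inv c) (chart_map c ` (chart_dom c \<inter> chart_dom d))"

definition smooth_map ::
  "'m topology \<Rightarrow> ('m, 'e::real_normed_vector) chart set \<Rightarrow>
   'n topology \<Rightarrow> ('n, 'f::real_normed_vector) chart set \<Rightarrow> ('m \<Rightarrow> 'n) \<Rightarrow> bool" where
  "smooth_map M A N B F \<longleftrightarrow>
     continuous_map M N F \<and>
     (\<forall>c\<in>A. \<forall>d\<in>B.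
        smooth_on (chart_map d \<circ> F \<circ> chart_inv c)
          (chart_map c ` (chart_dom c \<inter> F -` chart_dom d)))"

definition prod_atlas ::
  "('m, 'e) chart set \<Rightarrow> ('n, 'f) chart set \<Rightarrow> ('m \<times> 'n, 'e \<times> 'f) chart set" where
  "prod_atlas A B =
     {(chart_dom c \<times> chart_dom d, map_prod (chart_map c) (chart_map d)) | c d. c \<in> A \<and> d \<in> B}"

definition lie_group ::
  "('g, 'b) monoid_scheme \<Rightarrow> 'g topology \<Rightarrow> ('g, 'e::real_normed_vector) chart set \<Rightarrow> bool" where
  "lie_group G T A \<longleftrightarrow>
     group G \<and> topspace T = carrier G \<and> smooth_manifold T A \<and>
     smooth_map (prod_topology T T) (prod_atlas A A) T A (\<lambda>(g, h). g \<otimes>\<^bsub>G\<^esub> h) \<and>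
     smooth_map T A T A (\<lambda>g. inv\<^bsub>G\<^esub> g)"

definition smooth_action ::
  "('g, 'b) monoid_scheme \<Rightarrow> 'g topology \<Rightarrow> ('g, 'e::real_normed_vector) chart set \<Rightarrow>
   'm topology \<Rightarrow> ('m, 'f::real_normed_vector) chart set \<Rightarrow> ('g \<Rightarrow> 'm \<Rightarrow> 'm) \<Rightarrow> bool" where
  "smooth_action G T AG M A act \<longleftrightarrow>
     group_action G (topspace M) act \<and>
     smooth_map (prod_topology T M) (prod_atlas AG A) M A (\<lambda>(g, p). act g p)"

text \<open>The parameter domain \<open>I\<close> is an open subset of the line, with the identity as its only chart.\<close>

definition smooth_curve ::
  "real set \<Rightarrow> 'm topology \<Rightarrow> ('m, 'e::real_normed_vector) chart set \<Rightarrow> (real \<Rightarrow> 'm) \<Rightarrow> bool" where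
  "smooth_curve I M A \<gamma> \<longleftrightarrow> smooth_map (top_of_set I) {(I, \<lambda>t. t)} M A \<gamma>"

section \<open>The action in local coordinates and its infinitesimals\<close>

text \<open>The functions below are meaningful where the transformed point stays in the domain of the
  chart \<open>c\<close>, hence for each point of that domain as long as \<open>\<epsilon>\<close> is near \<open>0\<close>.\<close>

definition x_tilde ::
  "('m, real \<times> real) chart \<Rightarrow> ('g \<Rightarrow> 'm \<Rightarrow> 'm) \<Rightarrow> (real \<Rightarrow> 'g) \<Rightarrow> real \<times> real \<Rightarrow> real \<Rightarrow> real" where
  "x_tilde c act \<gamma> z \<epsilon> = fst (chart_map c (act (\<gamma> \<epsilon>) (chart_inv c z)))"

definition u_tilde ::
  "('m, real \<times> real) chart \<Rightarrow> ('g \<Rightarrow> 'm \<Rightarrow> 'm) \<Rightarrow> (real \<Rightarrow> 'g) \<Rightarrow> real \<times> real \<Rightarrow> real \<Rightarrow> real" where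
  "u_tilde c act \<gamma> z \<epsilon> = snd (chart_map c (act (\<gamma> \<epsilon>) (chart_inv c z)))"

definition xi ::
  "('m, real \<times> real) chart \<Rightarrow> ('g \<Rightarrow> 'm \<Rightarrow> 'm) \<Rightarrow> (real \<Rightarrow> 'g) \<Rightarrow> real \<times> real \<Rightarrow> real" where
  "xi c act \<gamma> z = deriv (x_tilde c act \<gamma> z) 0"

definition phi ::
  "('m, real \<times> real) chart \<Rightarrow> ('g \<Rightarrow> 'm \<Rightarrow> 'm) \<Rightarrow> (real \<Rightarrow> 'g) \<Rightarrow> real \<times> real \<Rightarrow> real" where
  "phi c act \<gamma> z = deriv (u_tilde c act \<gamma> z) 0"

section \<open>Vandermonde determinants and multispace coordinates\<close>

definition vandermonde_mat :: "nat \<Rightarrow> (nat \<Rightarrow> real) \<Rightarrow> real Matrix.mat" where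
  "vandermonde_mat k x = Matrix.mat (k + 1) (k + 1) (\<lambda>(i, j). x i ^ j)"

definition Delta :: "nat \<Rightarrow> (nat \<Rightarrow> real) \<Rightarrow> real" where
  "Delta k x = Determinant.det (vandermonde_mat k x)"

definition Delta_replace :: "nat \<Rightarrow> (nat \<Rightarrow> real) \<Rightarrow> (nat \<Rightarrow> real) \<Rightarrow> nat \<Rightarrow> real" where
  "Delta_replace k x w l =
     Determinant.det (replace_col (vandermonde_mat k x) (Matrix.vec (k + 1) w) l)"

definition w_hat :: "nat \<Rightarrow> (nat \<Rightarrow> real) \<Rightarrow> (nat \<Rightarrow> real) \<Rightarrow> real" where
  "w_hat k x w = fact k * (Delta_replace k x w k / Delta k x)"

definition mu_hat :: "nat \<Rightarrow> (nat \<Rightarrow> real) \<Rightarrow> (nat \<Rightarrow> real) \<Rightarrow> nat \<Rightarrow> real" where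
  "mu_hat k x u l = fact k * (Delta_replace k x u l / Delta k x)"

end

theory Submission
  imports Defs
begin

text \<open>
  The statement has an analytic and an algebraic half.

  \<^emph>\<open>Analysis.\<close> Near \<open>\<epsilon> = 0\<close>, the curve \<open>\<epsilon> \<mapsto> \<gamma>(\<epsilon>) \<cdot> (x\<^sub>i, u\<^sub>i)\<close>, read in the chart, is the
  action map in charts composed with \<open>\<epsilon> \<mapsto> (\<gamma>(\<epsilon>), (x\<^sub>i, u\<^sub>i))\<close>. The chain rule makes it differentiable at \<open>0\<close>, and
  it starts at \<open>(x\<^sub>i, u\<^sub>i)\<close> because \<open>\<gamma>(0)\<close> is the unit; this is \<open>orbit_chart_differentiable\<close>. The
  derivatives of its two coordinates are \<open>\<xi>\<close> and \<open>\<phi>\<close> by definition, so that from here on only the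
  sample points \<open>X\<^sub>i(\<epsilon>)\<close>, \<open>U\<^sub>i(\<epsilon>)\<close> and their velocities matter.

  \<^emph>\<open>Algebra.\<close> By Cramer's rule the numbers \<open>a\<^sub>l = \<Delta>(u, x\<^sup>l) / \<Delta>\<close> are the coefficients of the
  polynomial of degree at most \<open>k\<close> through the points \<open>(x\<^sub>i, u\<^sub>i)\<close>. Keep these coefficients fixed while
  the points move, and split \<open>U\<^sub>i = (\<Sum>l. a\<^sub>l X\<^sub>i\<^sup>l) + R\<^sub>i\<close>. The operator
  \<open>w_hat\<close> is linear in the sampled values and reads off \<open>k!\<close> times the coefficient of \<open>x\<^sup>k\<close> of a
  polynomial of degree at most \<open>k\<close>, so the first summand contributes the constant \<open>k! a\<^sub>k\<close>. The remainder \<open>R\<^sub>i\<close> vanishes at \<open>\<epsilon> = 0\<close>, so the product rule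
  leaves only the term in which \<open>R\<^sub>i\<close> is differentiated: the derivative is \<open>w_hat\<close>, at the initial
  points, of \<open>R'\<^sub>i(0) = \<phi>\<^sub>i - (\<Sum>l. a\<^sub>l l x\<^sub>i\<^sup>l\<^sup>-\<^sup>1 \<xi>\<^sub>i)\<close>. As \<open>mu_hat\<close> is \<open>k! a\<^sub>l\<close>, this is the claimed formula. No
  determinant is ever differentiated; it is enough that the Vandermonde determinant and its cofactors
  are continuous in the points. This half is
  \<open>w_hat_has_real_derivative\<close>.
\<close>

section \<open>Vandermonde systems\<close>

lemma vandermonde_carrier: "vandermonde_mat k x \<in> carrier_mat (k + 1) (k + 1)"
  by (simp add: vandermonde_mat_def)

text \<open>
  The simplifier rewrites \<open>k + 1\<close> to \<open>Suc k\<close>, so its rule must have that form.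
\<close>

lemmas vandermonde_carrier_Suc [simp] = vandermonde_carrier[unfolded Suc_eq_plus1[symmetric]]

lemma vandermonde_mult_vec_index:
  assumes "i \<le> k"
  shows "(vandermonde_mat k x *\<^sub>v Matrix.vec (k + 1) a) $ i = (\<Sum>l\<le>k. a l * x i ^ l)"
proof -
  have "(vandermonde_mat k x *\<^sub>v Matrix.vec (k + 1) a) $ i = (\<Sum>l<k+1. x i ^ l * a l)"
    using assms by (simp add: vandermonde_mat_def scalar_prod_def atLeast0LessThan)
  also have "\<dots> = (\<Sum>l\<le>k. a l * x i ^ l)"
    by (intro sum.cong) (auto simp: mult.commute)
  finally show ?thesis .
qed

text \<open>
  A vector in the kernel of the Vandermonde matrix lists the coefficients of a polynomial of degree
  at most \<open>k\<close> that vanishes at \<open>k + 1\<close> distinct points, so it is zero.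
\<close>

lemma Delta_nonzero:
  assumes inj: "inj_on x {0..k}"
  shows "Delta k x \<noteq> 0"
proof
  assume "Delta k x = 0"
  then obtain v where v: "v \<in> carrier_vec (k + 1)" "v \<noteq> 0\<^sub>v (k + 1)"
      "vandermonde_mat k x *\<^sub>v v = 0\<^sub>v (k + 1)"
    unfolding Delta_def using det_0_iff_vec_prod_zero[OF vandermonde_carrier] by blast
  define a where "a l = v $ l" for l
  have va: "v = Matrix.vec (k + 1) a"
    using v(1) by (auto simp: a_def)
  obtain m where m: "m \<le> k" "a m \<noteq> 0"
    using v(2) va by (auto simp: vec_eq_iff less_Suc_eq_le)
  have root: "(\<Sum>l\<le>k. a l * x i ^ l) = 0" if "i \<le> k" for i
    using vandermonde_mult_vec_index[OF that, of x a] v(3) va that by simp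
  have bound: "finite {z. (\<Sum>l\<le>k. a l * z ^ l) = 0}"
      "card {z. (\<Sum>l\<le>k. a l * z ^ l) = 0} \<le> k"
    using Poly_Roots.polyfun_rootbound[of k a] m by blast+
  have "card (x ` {0..k}) \<le> card {z. (\<Sum>l\<le>k. a l * z ^ l) = 0}"
    by (rule card_mono[OF bound(1)]) (auto simp: root)
  then show False
    using bound(2) card_image[OF inj] by simp
qed

text \<open>
  Laplace expansion along the replaced column: the cofactors of that column do not see the
  replacement. This gives linearity in \<open>w\<close> and isolates the dependence on the points in the
  cofactors.
\<close>

lemma Delta_replace_expand:
  assumes "l \<le> k"
  shows "Delta_replace k x w l = (\<Sum>i\<le>k. w i * cofactor (vandermonde_mat k x) i l)"
proof -
  let ?V = "vandermonde_mat k x" and ?w = "Matrix.vec (k + 1) w"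
  have del: "mat_delete (replace_col ?V ?w l) i l = mat_delete ?V i l" if "i \<le> k" for i
    using assms that by (intro eq_matI) (auto simp: mat_delete_def replace_col_def vandermonde_mat_def)
  have entry: "replace_col ?V ?w l $$ (i, l) = w i" if "i \<le> k" for i
    using assms that by (simp add: replace_col_def vandermonde_mat_def)
  have carrier: "replace_col ?V ?w l \<in> carrier_mat (k + 1) (k + 1)"
    by (simp add: replace_col_def vandermonde_mat_def)
  have "Delta_replace k x w l
      = (\<Sum>i<k+1. replace_col ?V ?w l $$ (i, l) * cofactor (replace_col ?V ?w l) i l)"
    unfolding Delta_replace_def using assms by (intro laplace_expansion_column[OF carrier]) simp
  also have "\<dots> = (\<Sum>i\<le>k. w i * cofactor ?V i l)"
    using assms
    by (intro sum.cong) (auto simp: cofactor_def del[simplified] entry[simplified])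
  finally show ?thesis .
qed

lemma Delta_replace_add:
  assumes "l \<le> k"
  shows "Delta_replace k x (\<lambda>i. v i + w i) l = Delta_replace k x v l + Delta_replace k x w l"
  by (simp add: Delta_replace_expand[OF assms] sum.distrib algebra_simps)

text \<open>
  Cramer's rule for sampled values of a polynomial: the values are the image of the coefficient
  vector under the Vandermonde matrix.
\<close>

lemma Delta_replace_polynomial:
  assumes "l \<le> k" and "\<And>i. i \<le> k \<Longrightarrow> w i = (\<Sum>m\<le>k. a m * x i ^ m)"
  shows "Delta_replace k x w l = a l * Delta k x"
proof -
  have "Matrix.vec (k + 1) w = vandermonde_mat k x *\<^sub>v Matrix.vec (k + 1) a"
  proof (intro eq_vecI)
    fix i assume "i < dim_vec (vandermonde_mat k x *\<^sub>v Matrix.vec (k + 1) a)"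
    then have "i \<le> k" by (simp add: vandermonde_mat_def)
    then show "Matrix.vec (k + 1) w $ i = (vandermonde_mat k x *\<^sub>v Matrix.vec (k + 1) a) $ i"
      by (subst vandermonde_mult_vec_index) (auto simp: assms(2))
  qed (simp add: vandermonde_mat_def)
  then show ?thesis
    using cramer_lemma_mat[OF vandermonde_carrier, of "Matrix.vec (k + 1) a" k l x] assms(1)
    by (simp add: Delta_replace_def Delta_def)
qed

text \<open>
  Conversely, the Cramer quotients are interpolation coefficients: the adjugate provides some solution
  of the Vandermonde system, and \<open>Delta_replace_polynomial\<close> identifies its entries.
\<close>

lemma interpolation:
  assumes "Delta k x \<noteq> 0" and "i \<le> k"
  shows "(\<Sum>l\<le>k. (Delta_replace k x w l / Delta k x) * x i ^ l) = w i"
proof -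
  let ?V = "vandermonde_mat k x" and ?w = "Matrix.vec (k + 1) w"
  define v where "v = (1 / Delta k x) \<cdot>\<^sub>v (adj_mat ?V *\<^sub>v ?w)"
  define a where "a l = v $ l" for l
  have adj: "adj_mat ?V \<in> carrier_mat (k + 1) (k + 1)"
    "?V * adj_mat ?V = Delta k x \<cdot>\<^sub>m 1\<^sub>m (k + 1)"
    using adj_mat[OF vandermonde_carrier] by (simp_all add: Delta_def)
  have v: "v = Matrix.vec (k + 1) a"
    using adj(1) by (auto simp: v_def a_def)
  have smult: "(d \<cdot>\<^sub>m 1\<^sub>m n) *\<^sub>v y = d \<cdot>\<^sub>v y" if "y \<in> carrier_vec n"
    for d :: real and n and y
  proof -
    have "(d \<cdot>\<^sub>m 1\<^sub>m n) *\<^sub>v y = d \<cdot>\<^sub>v (1\<^sub>m n *\<^sub>v y)"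
      using that by auto
    then show ?thesis
      using that by simp
  qed
  have "?V *\<^sub>v v = (1 / Delta k x) \<cdot>\<^sub>v (?V *\<^sub>v (adj_mat ?V *\<^sub>v ?w))"
    unfolding v_def using adj(1) by (intro mult_mat_vec[OF vandermonde_carrier]) auto
  also have "?V *\<^sub>v (adj_mat ?V *\<^sub>v ?w) = (?V * adj_mat ?V) *\<^sub>v ?w"
    by (rule assoc_mult_mat_vec[OF vandermonde_carrier adj(1), symmetric]) simp
  also have "\<dots> = Delta k x \<cdot>\<^sub>v ?w"
    unfolding adj(2) by (rule smult) simp
  finally have "?V *\<^sub>v v = ?w"
    using assms(1) by (auto simp: smult_smult_assoc)
  then have w: "w j = (\<Sum>l\<le>k. a l * x j ^ l)" if "j \<le> k" for j
    using vandermonde_mult_vec_index[OF that, of x a] v that by simp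
  have "Delta_replace k x w l / Delta k x = a l" if "l \<le> k" for l
    using Delta_replace_polynomial[OF that, of w a x] w assms(1) by simp
  then show ?thesis
    using w[OF assms(2)] by simp
qed

section \<open>The derivative of a moving divided difference\<close>

text \<open>
  The Leibniz formula exhibits the determinant as a polynomial in the entries.
\<close>

lemma tendsto_det:
  fixes B :: "'a \<Rightarrow> real Matrix.mat"
  assumes "\<And>t. B t \<in> carrier_mat n n" and "C \<in> carrier_mat n n"
    and "\<And>i j. i < n \<Longrightarrow> j < n \<Longrightarrow> ((\<lambda>t. B t $$ (i, j)) \<longlongrightarrow> C $$ (i, j)) F"
  shows "((\<lambda>t. Determinant.det (B t)) \<longlongrightarrow> Determinant.det C) F"
  unfolding det_def'[OF assms(1)] det_def'[OF assms(2)]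
  by (intro tendsto_intros assms(3)) (auto simp: permutes_in_image)

lemma tendsto_vandermonde_entry:
  assumes "\<And>i. i \<le> k \<Longrightarrow> ((\<lambda>t. X i t) \<longlongrightarrow> x i) F" and "i \<le> k" "j \<le> k"
  shows "((\<lambda>t. vandermonde_mat k (\<lambda>i. X i t) $$ (i, j)) \<longlongrightarrow> vandermonde_mat k x $$ (i, j)) F"
  using assms by (auto simp: vandermonde_mat_def intro!: tendsto_intros)

lemma tendsto_Delta:
  assumes "\<And>i. i \<le> k \<Longrightarrow> ((\<lambda>t. X i t) \<longlongrightarrow> x i) F"
  shows "((\<lambda>t. Delta k (\<lambda>i. X i t)) \<longlongrightarrow> Delta k x) F"
  unfolding Delta_def
  by (rule tendsto_det[OF vandermonde_carrier vandermonde_carrier])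
     (auto intro!: tendsto_vandermonde_entry assms)

lemma tendsto_cofactor_vandermonde:
  assumes "\<And>i. i \<le> k \<Longrightarrow> ((\<lambda>t. X i t) \<longlongrightarrow> x i) F" and "m \<le> k" "l \<le> k"
  shows "((\<lambda>t. cofactor (vandermonde_mat k (\<lambda>i. X i t)) m l)
           \<longlongrightarrow> cofactor (vandermonde_mat k x) m l) F"
proof -
  have "((\<lambda>t. Determinant.det (mat_delete (vandermonde_mat k (\<lambda>i. X i t)) m l))
      \<longlongrightarrow> Determinant.det (mat_delete (vandermonde_mat k x) m l)) F"
  proof (rule tendsto_det)
    show "mat_delete (vandermonde_mat k y) m l \<in> carrier_mat k k" for y
      using mat_delete_carrier[OF vandermonde_carrier, of k y m l] by simp
    then show "mat_delete (vandermonde_mat k x) m l \<in> carrier_mat k k" .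
    fix i j assume "i < k" "j < k"
    then show "((\<lambda>t. mat_delete (vandermonde_mat k (\<lambda>i. X i t)) m l $$ (i, j))
        \<longlongrightarrow> mat_delete (vandermonde_mat k x) m l $$ (i, j)) F"
      using assms by (auto simp: mat_delete_def vandermonde_mat_def intro!: tendsto_intros)
  qed
  then show ?thesis
    unfolding cofactor_def by (intro tendsto_intros)
qed

text \<open>
  The product rule at a zero of one factor asks only for a limit of the other, since the difference
  quotient of the product is the difference quotient of \<open>R\<close> times \<open>Q\<close>. It spares the derivatives of
  the cofactors and of the Vandermonde determinant.
\<close>

lemma has_real_derivative_mult_vanishing:
  fixes Q R :: "real \<Rightarrow> real"
  assumes "Q \<midarrow>t\<rightarrow> q" and "(R has_real_derivative r) (at t)" and "R t = 0"
  shows "((\<lambda>s. R s * Q s) has_real_derivative r * q) (at t)"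
proof -
  have "(\<lambda>s. (R s - R t) / (s - t) * Q s) \<midarrow>t\<rightarrow> r * q"
    using assms(1,2) by (intro tendsto_intros) (simp add: has_field_derivative_iff)
  then show ?thesis
    using assms(3) by (simp add: has_field_derivative_iff)
qed

lemma w_hat_expand:
  "w_hat k x w = (\<Sum>i\<le>k. w i * (fact k * cofactor (vandermonde_mat k x) i k / Delta k x))"
  by (simp add: w_hat_def Delta_replace_expand sum_distrib_left sum_divide_distrib algebra_simps)

text \<open>
  The infinitesimal formula for arbitrary moving sample points. The coefficients \<open>a\<close> of the
  interpolating polynomial are those at time \<open>t\<close> and stay constant, so that only the
  remainder \<open>R\<close>, which vanishes at time \<open>t\<close>, contributes to the derivative.
\<close>

lemma w_hat_has_real_derivative:
  assumes X: "\<And>i. i \<le> k \<Longrightarrow> ((\<lambda>s. X i s) has_real_derivative \<xi> i) (at t)"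
    and U: "\<And>i. i \<le> k \<Longrightarrow> ((\<lambda>s. U i s) has_real_derivative \<phi> i) (at t)"
    and x: "\<And>i. i \<le> k \<Longrightarrow> X i t = x i" and u: "\<And>i. i \<le> k \<Longrightarrow> U i t = u i"
    and inj: "inj_on x {0..k}"
  shows "((\<lambda>s. w_hat k (\<lambda>i. X i s) (\<lambda>i. U i s)) has_real_derivative
      w_hat k x \<phi> - 1 / fact k *
        (\<Sum>l=0..k. mu_hat k x u l * w_hat k x (\<lambda>i. real l * x i ^ (l - 1) * \<xi> i))) (at t)"
proof -
  define a where "a l = Delta_replace k x u l / Delta k x" for l
  define R where "R i s = U i s - (\<Sum>l\<le>k. a l * X i s ^ l)" for i s
  define r where "r i = \<phi> i - (\<Sum>l\<le>k. a l * (real l * x i ^ (l - 1) * \<xi> i))" for i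
  define Q where "Q i y = fact k * cofactor (vandermonde_mat k y) i k / Delta k y" for i y
  have Delta: "Delta k x \<noteq> 0"
    by (rule Delta_nonzero[OF inj])
  have lim: "(\<lambda>s. X i s) \<midarrow>t\<rightarrow> x i" if "i \<le> k" for i
    using DERIV_isCont[OF X[OF that]] x[OF that] by (simp add: isCont_def)
  have R_zero: "R i t = 0" if "i \<le> k" for i
    using interpolation[OF Delta that, of u] that by (simp add: R_def a_def x u)
  have R_deriv: "((\<lambda>s. R i s) has_real_derivative r i) (at t)" if "i \<le> k" for i
    unfolding R_def r_def
    by (rule derivative_eq_intros U X that refl)+ (simp add: x that ac_simps)
  have Q_lim: "(\<lambda>s. Q i (\<lambda>i. X i s)) \<midarrow>t\<rightarrow> Q i x" if "i \<le> k" for i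
    unfolding Q_def
    using that Delta
    by (intro tendsto_intros tendsto_Delta tendsto_cofactor_vandermonde lim) auto
  have deriv: "((\<lambda>s. fact k * a k + (\<Sum>i\<le>k. R i s * Q i (\<lambda>i. X i s)))
      has_real_derivative 0 + (\<Sum>i\<le>k. r i * Q i x)) (at t)"
    by (intro DERIV_add DERIV_const DERIV_sum has_real_derivative_mult_vanishing
          Q_lim R_deriv R_zero) auto
  \<comment> \<open>Away from degenerate configurations the interpolating part contributes a constant.\<close>
  have decomp: "fact k * a k + (\<Sum>i\<le>k. R i s * Q i (\<lambda>i. X i s)) = w_hat k (\<lambda>i. X i s) (\<lambda>i. U i s)"
    if "Delta k (\<lambda>i. X i s) \<noteq> 0" for s
  proof -
    let ?x = "\<lambda>i. X i s"
    let ?p = "\<lambda>i. \<Sum>l\<le>k. a l * ?x i ^ l"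
    have "w_hat k ?x (\<lambda>i. U i s) = w_hat k ?x (\<lambda>i. ?p i + R i s)"
      by (simp add: R_def)
    also have "\<dots> = w_hat k ?x ?p + w_hat k ?x (\<lambda>i. R i s)"
      by (simp add: w_hat_def Delta_replace_add add_divide_distrib distrib_left)
    also have "w_hat k ?x ?p = fact k * a k"
      using that by (simp add: w_hat_def Delta_replace_polynomial[where a = a])
    finally show ?thesis
      by (simp add: w_hat_expand Q_def)
  qed
  have near: "\<forall>\<^sub>F s in nhds t. Delta k (\<lambda>i. X i s) \<noteq> 0"
  proof -
    have "(\<lambda>s. Delta k (\<lambda>i. X i s)) \<midarrow>t\<rightarrow> Delta k x"
      by (rule tendsto_Delta) (rule lim)
    then have "\<forall>\<^sub>F s in at t. Delta k (\<lambda>i. X i s) \<noteq> 0"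
      using Delta by (rule tendsto_imp_eventually_ne)
    moreover have "Delta k (\<lambda>i. X i t) \<noteq> 0"
      using inj by (intro Delta_nonzero) (simp add: inj_on_def x)
    ultimately show ?thesis
      by (simp add: eventually_nhds_conv_at)
  qed
  have coefficient: "0 + (\<Sum>i\<le>k. r i * Q i x) = w_hat k x \<phi> - 1 / fact k *
        (\<Sum>l=0..k. mu_hat k x u l * w_hat k x (\<lambda>i. real l * x i ^ (l - 1) * \<xi> i))"
  proof -
    have "(\<Sum>i\<le>k. r i * Q i x) = (\<Sum>i\<le>k. \<phi> i * Q i x)
        - (\<Sum>i\<le>k. \<Sum>l\<le>k. a l * (real l * x i ^ (l - 1) * \<xi> i) * Q i x)"
      by (simp add: r_def left_diff_distrib sum_subtractf sum_distrib_right)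
    also have "(\<Sum>i\<le>k. \<Sum>l\<le>k. a l * (real l * x i ^ (l - 1) * \<xi> i) * Q i x)
        = (\<Sum>l\<le>k. a l * (\<Sum>i\<le>k. (real l * x i ^ (l - 1) * \<xi> i) * Q i x))"
      by (subst sum.swap) (simp add: sum_distrib_left mult.assoc)
    also have "\<dots> = 1 / fact k * (\<Sum>l=0..k. mu_hat k x u l *
        w_hat k x (\<lambda>i. real l * x i ^ (l - 1) * \<xi> i))"
      by (simp add: w_hat_expand Q_def mu_hat_def a_def atMost_atLeast0 sum_distrib_left ac_simps)
    finally show ?thesis
      by (simp add: w_hat_expand Q_def)
  qed
  show ?thesis
    using deriv unfolding coefficient
    by (rule DERIV_cong_ev[THEN iffD1, rotated -1])
       (auto intro: eventually_mono[OF near] simp: decomp)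
qed

section \<open>Orbits of points in a chart\<close>

lemma smooth_on_imp_differentiable:
  assumes "smooth_on f S" and "z \<in> S"
  shows "f differentiable (at z)"
proof -
  have "Ck_on (Suc 0) f S"
    using assms(1) unfolding smooth_on_def by blast
  then show ?thesis
    using assms(2) by simp
qed

lemma (in smooth_manifold) chart_inj:
  assumes "c \<in> A"
  shows "inj_on (chart_map c) (chart_dom c)"
proof -
  have "topspace (subtopology M (chart_dom c)) = chart_dom c"
    using openin_subset[OF chart_openin[OF assms]] by auto
  then show ?thesis
    using homeomorphic_imp_injective_map[OF chart_homeo[OF assms]] by simp
qed

lemma differentiable_transform_eventually:
  assumes "f differentiable (at x)" and "\<forall>\<^sub>F y in nhds x. f y = g y"
  shows "g differentiable (at x)"
  using assms has_derivative_transform_eventually[of f _ x UNIV g]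
  unfolding differentiable_def eventually_nhds_conv_at by auto

text \<open>
  Openness of \<open>I\<close> turns the relatively open preimage of the chart domain into a neighbourhood of
  \<open>t\<close>, on which the chart inverse of the identity chart of \<open>I\<close> is the identity.
\<close>

lemma smooth_curve_chart_differentiable:
  assumes "open I" "t \<in> I" "smooth_curve I N A \<gamma>" "a \<in> A" "openin N (chart_dom a)" "\<gamma> t \<in> chart_dom a"
  shows "\<forall>\<^sub>F s in nhds t. \<gamma> s \<in> chart_dom a"
    and "(\<lambda>s. chart_map a (\<gamma> s)) differentiable (at t)"
proof -
  have sm: "smooth_map (top_of_set I) {(I, \<lambda>t. t)} N A \<gamma>"
    using assms(3) by (simp add: smooth_curve_def)
  define J where "J = {s \<in> I. \<gamma> s \<in> chart_dom a}"
  have "openin (top_of_set I) J"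
    using openin_continuous_map_preimage[of "top_of_set I" N \<gamma>, OF _ assms(5)] sm
    by (simp add: smooth_map_def J_def)
  then have "open J"
    using assms(1) openin_open_eq by blast
  moreover have "t \<in> J"
    using assms by (simp add: J_def)
  ultimately have ev: "\<forall>\<^sub>F s in nhds t. s \<in> J"
    by (rule eventually_nhds_in_open)
  then show "\<forall>\<^sub>F s in nhds t. \<gamma> s \<in> chart_dom a"
    by (rule eventually_mono) (simp add: J_def)
  have id: "chart_inv (I, \<lambda>t. t) s = s" if "s \<in> I" for s :: real
    using inv_into_f_f[of "\<lambda>t. t" I s] that by (simp add: chart_inv_def inj_on_def)
  have "smooth_on (chart_map a \<circ> \<gamma> \<circ> chart_inv (I, \<lambda>t. t)) J"
  proof -
    have "J = (\<lambda>t. t) ` (I \<inter> \<gamma> -` chart_dom a)" by (auto simp: J_def)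
    then show ?thesis using sm assms(4) by (auto simp: smooth_map_def)
  qed
  then have "(chart_map a \<circ> \<gamma> \<circ> chart_inv (I, \<lambda>t. t)) differentiable (at t)"
    using \<open>t \<in> J\<close> by (rule smooth_on_imp_differentiable)
  then show "(\<lambda>s. chart_map a (\<gamma> s)) differentiable (at t)"
    by (rule differentiable_transform_eventually)
       (rule eventually_mono[OF ev], simp add: id J_def)
qed

text \<open>
  The chain rule in a product chart \<open>d\<close> around \<open>(\<one>, p)\<close>. A chart around the unit is enough because
  \<open>\<gamma>\<close> stays in its domain for small times. Only for those times is \<open>chart_inv d\<close> known to
  recover \<open>(\<gamma> \<epsilon>, p)\<close> from its coordinates, so the orbit agrees with the composition near \<open>0\<close> only.
\<close>

lemma orbit_chart_differentiable:
  assumes G: "lie_group G TG AG" and M: "smooth_manifold M A" and act: "smooth_action G TG AG M A act"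
    and c: "c \<in> A" and I: "open I" "0 \<in> I" and \<gamma>: "smooth_curve I TG AG \<gamma>" and \<gamma>0: "\<gamma> 0 = \<one>\<^bsub>G\<^esub>"
    and z: "z \<in> chart_map c ` chart_dom c"
  shows "chart_map c (act (\<gamma> 0) (chart_inv c z)) = z"
    and "(\<lambda>\<epsilon>. chart_map c (act (\<gamma> \<epsilon>) (chart_inv c z))) differentiable (at 0)"
proof -
  interpret M: smooth_manifold M A by (rule M)
  interpret TG: smooth_manifold TG AG using G by (simp add: lie_group_def)
  interpret group_action G "topspace M" act using act by (simp add: smooth_action_def)
  interpret group G using G by (simp add: lie_group_def)
  define p where "p = chart_inv c z"
  have p: "p \<in> chart_dom c" "chart_map c p = z"
    using z by (auto simp: p_def chart_inv_def inv_into_into f_inv_into_f)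
  have "p \<in> topspace M"
    using p(1) openin_subset[OF M.chart_openin[OF c]] by blast
  then have act_one: "act \<one>\<^bsub>G\<^esub> p = p"
    using id_eq_one by (metis restrict_apply')
  then show "chart_map c (act (\<gamma> 0) (chart_inv c z)) = z"
    using p by (simp add: \<gamma>0 p_def)
  have "\<one>\<^bsub>G\<^esub> \<in> (\<Union>a\<in>AG. chart_dom a)"
    using G TG.charts_cover by (simp add: lie_group_def)
  then obtain a where a: "a \<in> AG" "\<one>\<^bsub>G\<^esub> \<in> chart_dom a"
    by blast
  have curve: "\<forall>\<^sub>F s in nhds 0. \<gamma> s \<in> chart_dom a" "(\<lambda>s. chart_map a (\<gamma> s)) differentiable (at 0)"
    using smooth_curve_chart_differentiable[OF I \<gamma> a(1) TG.chart_openin[OF a(1)]] a(2) \<gamma>0 by auto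
  define d where "d = (chart_dom a \<times> chart_dom c, map_prod (chart_map a) (chart_map c))"
  have d_inv: "chart_inv d (chart_map a g, z) = (g, p)" if "g \<in> chart_dom a" for g
  proof -
    have "inj_on (chart_map d) (chart_dom d)"
      using map_prod_inj_on[OF TG.chart_inj[OF a(1)] M.chart_inj[OF c]] by (simp add: d_def)
    then show ?thesis
      using inv_into_f_f[of "chart_map d" "chart_dom d" "(g, p)"] that p
      by (simp add: chart_inv_def d_def)
  qed
  let ?F = "\<lambda>(g, q). act g q"
  let ?f = "chart_map c \<circ> ?F \<circ> chart_inv d"
  have smooth: "smooth_on ?f (chart_map d ` (chart_dom d \<inter> ?F -` chart_dom c))"
  proof -
    have "d \<in> prod_atlas AG A"
      unfolding prod_atlas_def d_def using a(1) c by blast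
    then show ?thesis
      using act c unfolding smooth_action_def smooth_map_def by blast
  qed
  have "(chart_map a \<one>\<^bsub>G\<^esub>, z) \<in> chart_map d ` (chart_dom d \<inter> ?F -` chart_dom c)"
    by (rule image_eqI[where x = "(\<one>\<^bsub>G\<^esub>, p)"]) (auto simp: d_def p a act_one)
  then have f_diff: "?f differentiable (at (chart_map a (\<gamma> 0), z))"
    unfolding \<gamma>0 by (rule smooth_on_imp_differentiable[OF smooth])
  have "(\<lambda>s. (chart_map a (\<gamma> s), z)) differentiable (at 0)"
    using curve(2) unfolding differentiable_def
    by (elim exE) (rule exI, rule has_derivative_Pair[OF _ has_derivative_const])
  then have "(?f \<circ> (\<lambda>s. (chart_map a (\<gamma> s), z))) differentiable (at 0)"
    using f_diff by (rule differentiable_chain_at)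
  then have "(\<lambda>\<epsilon>. chart_map c (act (\<gamma> \<epsilon>) p)) differentiable (at 0)"
    by (rule differentiable_transform_eventually)
       (rule eventually_mono[OF curve(1)], simp add: d_inv)
  then show "(\<lambda>\<epsilon>. chart_map c (act (\<gamma> \<epsilon>) (chart_inv c z))) differentiable (at 0)"
    by (simp add: p_def)
qed

theorem proposition4p2:
  fixes G :: "('g, 'b) monoid_scheme"
    and TG :: "'g topology"
    and AG :: "('g, 'e::real_normed_vector) chart set"
    and M :: "'m topology"
    and A :: "('m, real \<times> real) chart set"
    and act :: "'g \<Rightarrow> 'm \<Rightarrow> 'm"
    and c :: "('m, real \<times> real) chart"
    and I :: "real set"
    and \<gamma> :: "real \<Rightarrow> 'g"
    and k :: nat
    and x u :: "nat \<Rightarrow> real"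
  assumes "lie_group G TG AG"
    and "smooth_manifold M A"
    and "smooth_action G TG AG M A act"
    and "c \<in> A"
    and "open I" and "is_interval I" and "0 \<in> I"
    and "smooth_curve I TG AG \<gamma>"
    and "\<gamma> 0 = \<one>\<^bsub>G\<^esub>"
    and "\<And>i. i \<le> k \<Longrightarrow> (x i, u i) \<in> chart_map c ` chart_dom c"
    and "inj_on x {0..k}"
  shows "((\<lambda>\<epsilon>. w_hat k (\<lambda>i. x_tilde c act \<gamma> (x i, u i) \<epsilon>) (\<lambda>i. u_tilde c act \<gamma> (x i, u i) \<epsilon>))
           has_real_derivative
             w_hat k x (\<lambda>i. phi c act \<gamma> (x i, u i))
             - 1 / fact k *
               (\<Sum>l=0..k. mu_hat k x u l *
                  w_hat k x (\<lambda>i. real l * x i ^ (l - 1) * xi c act \<gamma> (x i, u i))))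
         (at 0)"
proof -
  note orbit = orbit_chart_differentiable[OF assms(1-5,7-9) assms(10)]
  have "x_tilde c act \<gamma> (x i, u i) differentiable (at 0)" if "i \<le> k" for i
    using orbit(2)[OF that] unfolding x_tilde_def[abs_def] differentiable_def
    by (elim exE) (rule exI, rule has_derivative_fst)
  moreover have "u_tilde c act \<gamma> (x i, u i) differentiable (at 0)" if "i \<le> k" for i
    using orbit(2)[OF that] unfolding u_tilde_def[abs_def] differentiable_def
    by (elim exE) (rule exI, rule has_derivative_snd)
  ultimately have deriv:
    "((\<lambda>\<epsilon>. x_tilde c act \<gamma> (x i, u i) \<epsilon>) has_real_derivative xi c act \<gamma> (x i, u i)) (at 0)"
    "((\<lambda>\<epsilon>. u_tilde c act \<gamma> (x i, u i) \<epsilon>) has_real_derivative phi c act \<gamma> (x i, u i)) (at 0)"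
    if "i \<le> k" for i
    using that unfolding xi_def phi_def
    by (simp_all add: DERIV_deriv_iff_real_differentiable)
  have initial: "x_tilde c act \<gamma> (x i, u i) 0 = x i" "u_tilde c act \<gamma> (x i, u i) 0 = u i"
    if "i \<le> k" for i
    using orbit(1)[OF that] by (simp_all add: x_tilde_def u_tilde_def)
  show ?thesis
    by (rule w_hat_has_real_derivative[OF deriv initial assms(11)])
qed

end
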